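(* Every $3$-degenerate claw-free graph $G$ is equitable list point $k$-arborable for every integer $k\geq \max\{\lceil (\Delta(G)+1)/2\rceil,3\}$, where $\Delta(G)$ is the maximum degree of $G$.
   Context: All graphs are finite, simple and undirected. A graph is $d$-degenerate if every subgraph of it has a vertex of degree at most $d$. A graph is claw-free if it has no induced subgraph isomorphic to $K_{1,3}$. A $k$-list assignment of a graph $G$ assigns to each vertex $v$ a set (list) $L(v)$ of $k$ colors. A graph $G$ is equitable list point $k$-arborable if for every $k$-list assignment $L$ one can choose $c(v)\in L(v)$ for each vertex $v$ such that each color class induces an acyclic subgraph (a forest) of $G$ and each color appears on at most $\lceil |V(G)|/k\rceil$ vertices of $G$. *)

theory Defs
  imports Complex_Main "Graph_Theory.Graph_Theory"
begin

text \<open>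
  Finite simple undirected graphs are rendered by the locale \<open>graph\<close>: finite, loop-free,
  symmetric digraphs without parallel arcs. An undirected edge is a pair of opposite arcs, so the
  degree of a vertex is its out-degree.
\<close>

text \<open>
  The condition \<open>graph H\<close> restricts to subgraphs in the undirected sense, that is, those
  containing with every arc also the opposite one.
\<close>

definition degenerate :: "nat \<Rightarrow> ('a, 'b) pre_digraph \<Rightarrow> bool" where
  "degenerate d G \<longleftrightarrow>
     (\<forall>H. subgraph H G \<and> graph H \<and> verts H \<noteq> {} \<longrightarrow> (\<exists>v \<in> verts H. out_degree H v \<le> d))"

definition claw_free :: "('a, 'b) pre_digraph \<Rightarrow> bool" where
  "claw_free G \<longleftrightarrow> \<not> (\<exists>H. induced_subgraph H G \<and> complete_bipartite_digraph 1 3 H)"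

text \<open>The element \<open>0\<close> only matters for the graph without vertices.\<close>

definition max_degree :: "('a, 'b) pre_digraph \<Rightarrow> nat" where
  "max_degree G = Max (insert 0 (out_degree G ` verts G))"

text \<open>
  In a symmetric digraph the two arcs of an undirected edge form a \<open>cycle\<close> of length 2, so the
  library's \<open>forest\<close> would exclude every edge. Cycles of length at least 3 are exactly the cycles
  of the undirected graph.
\<close>

definition acyclic_graph :: "('a, 'b) pre_digraph \<Rightarrow> bool" where
  "acyclic_graph G \<longleftrightarrow> \<not> (\<exists>p. pre_digraph.cycle G p \<and> 3 \<le> length p)"

definition list_assignment :: "nat \<Rightarrow> ('a, 'b) pre_digraph \<Rightarrow> ('a \<Rightarrow> 'c set) \<Rightarrow> bool" where
  "list_assignment k G L \<longleftrightarrow> (\<forall>v \<in> verts G. finite (L v) \<and> card (L v) = k)"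

definition color_class :: "('a, 'b) pre_digraph \<Rightarrow> ('a \<Rightarrow> 'c) \<Rightarrow> 'c \<Rightarrow> 'a set" where
  "color_class G c x = {v \<in> verts G. c v = x}"

text \<open>The type argument is the type of colors, which a statement can leave arbitrary.\<close>

definition equitable_list_point_arborable ::
    "'c itself \<Rightarrow> nat \<Rightarrow> ('a, 'b) pre_digraph \<Rightarrow> bool" where
  "equitable_list_point_arborable _ k G \<longleftrightarrow>
     (\<forall>L :: 'a \<Rightarrow> 'c set. list_assignment k G L \<longrightarrow>
       (\<exists>c. (\<forall>v \<in> verts G. c v \<in> L v) \<and>
            (\<forall>x. acyclic_graph (induce_subgraph G (color_class G c x))) \<and>
            (\<forall>x. int (card (color_class G c x)) \<le> \<lceil>real (card (verts G)) / real k\<rceil>)))"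

end

theory Submission
  imports Defs
begin

text \<open>
  Remove \<open>k\<close> vertices \<open>v\<^sub>0, \<dots>, v\<^bsub>k-1\<^esub>\<close> such that \<open>v\<^sub>j\<close> has at most \<open>2 j + 1\<close> neighbours among
  the remaining vertices, and colour the rest by induction. At most \<open>j\<close> colours occur twice or more
  around \<open>v\<^sub>j\<close>, so \<open>v\<^sub>j\<close> keeps \<open>k - j\<close> colours, and choosing in the order \<open>v\<^bsub>k-1\<^esub>, \<dots>, v\<^sub>0\<close> gives the
  removed vertices pairwise different ones. Every colour class then grows by at most one vertex, which
  has at most one neighbour in it, so it remains a forest.

  To find the \<open>v\<^sub>j\<close>, let \<open>x = v\<^sub>0\<close> have degree at most 3. If the degree is 3, claw-freeness gives two
  adjacent neighbours \<open>a = v\<^bsub>k-2\<^esub>\<close> and \<open>b = v\<^bsub>k-1\<^esub>\<close> of \<open>x\<close>, and \<open>a\<close> has at most \<open>\<Delta> - 2 \<le> 2 k - 3\<close>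
  neighbours outside the triangle. Otherwise let \<open>b\<close> be a neighbour of \<open>x\<close> and \<open>a\<close> a vertex of degree
  at most 3 in the rest. The other \<open>v\<^sub>j\<close> are taken successively of degree at most 3 in what remains.
\<close>

section \<open>Degeneracy of vertex sets\<close>

text \<open>Testing induced subgraphs suffices, since deleting edges only lowers degrees. With a
  neighbourhood function \<open>N\<close> and a set \<open>A\<close>, vertices can be removed
  without building new graphs. For symmetric irreflexive \<open>N\<close> and finite
  \<open>A\<close>, the case \<open>d = 1\<close> describes induced forests.\<close>

definition degenerate_on :: "('a \<Rightarrow> 'a set) \<Rightarrow> nat \<Rightarrow> 'a set \<Rightarrow> bool" where
  "degenerate_on N d A \<longleftrightarrow> (\<forall>B\<subseteq>A. B \<noteq> {} \<longrightarrow> (\<exists>v\<in>B. card (N v \<inter> B) \<le> d))"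

lemma degenerate_onD:
  assumes "degenerate_on N d A" "B \<subseteq> A" "B \<noteq> {}"
  obtains v where "v \<in> B" "card (N v \<inter> B) \<le> d"
  using assms unfolding degenerate_on_def by blast

lemma degenerate_on_subset: "degenerate_on N d A \<Longrightarrow> B \<subseteq> A \<Longrightarrow> degenerate_on N d B"
  unfolding degenerate_on_def by blast

lemma degenerate_on_insert:
  assumes "finite A" "degenerate_on N d A" "v \<notin> N v" "card (N v \<inter> A) \<le> d"
  shows "degenerate_on N d (insert v A)"
  unfolding degenerate_on_def
proof (intro allI impI)
  fix B assume B: "B \<subseteq> insert v A" "B \<noteq> {}"
  show "\<exists>v\<in>B. card (N v \<inter> B) \<le> d"
  proof (cases "v \<in> B")
    case True
    have "N v \<inter> B \<subseteq> N v \<inter> A" using B assms(3) by auto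
    then have "card (N v \<inter> B) \<le> card (N v \<inter> A)" using assms(1) by (simp add: card_mono)
    with True assms(4) show ?thesis by (meson order_trans)
  next
    case False
    then have "B \<subseteq> A" using B by auto
    with assms(2) B(2) show ?thesis unfolding degenerate_on_def by blast
  qed
qed

section \<open>Distinct representatives and repeated values\<close>

text \<open>Choosing from the end of the list backwards, \<open>vs ! j\<close> competes with at most
  \<open>length vs - j - 1\<close> values already taken, one fewer than \<open>A (vs ! j)\<close> is
  sure to offer.\<close>

lemma distinct_representatives_greedy:
  assumes "distinct vs"
    and "\<And>j. j < length vs \<Longrightarrow> length vs - j \<le> card (A (vs ! j))"
  obtains d where "inj_on d (set vs)" "\<And>v. v \<in> set vs \<Longrightarrow> d v \<in> A v"
proof -
  have "\<exists>d. inj_on d (set vs) \<and> (\<forall>v\<in>set vs. d v \<in> A v)"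
    using assms
  proof (induction vs)
    case Nil
    then show ?case by simp
  next
    case (Cons v vs)
    have "length vs - j \<le> card (A (vs ! j))" if "j < length vs" for j
      using Cons.prems(2)[of "Suc j"] that by simp
    with Cons obtain d where d: "inj_on d (set vs)" "\<forall>v\<in>set vs. d v \<in> A v" by auto
    have "card (d ` set vs) \<le> length vs"
      by (meson card_image_le card_length finite_set order_trans)
    also have "\<dots> < card (A v)" using Cons.prems(2)[of 0] by simp
    finally have "\<not> A v \<subseteq> d ` set vs" by (meson card_mono finite_imageI finite_set not_le)
    then obtain y where y: "y \<in> A v" "y \<notin> d ` set vs" by blast
    have v: "v \<notin> set vs" using Cons.prems(1) by simp
    have "inj_on (d(v := y)) (set (v # vs))"
      using d(1) y(2) v by (auto simp: inj_on_def)
    moreover have "\<forall>w\<in>set (v # vs). (d(v := y)) w \<in> A w" using d(2) y(1) by auto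
    ultimately show ?case by blast
  qed
  with that show thesis by blast
qed

lemma finite_repeated_values:
  assumes "finite M"
  shows "finite {y. 2 \<le> card {u\<in>M. c u = y}}"
proof (rule finite_subset)
  show "{y. 2 \<le> card {u\<in>M. c u = y}} \<subseteq> c ` M"
  proof
    fix y assume "y \<in> {y. 2 \<le> card {u\<in>M. c u = y}}"
    then have "card {u\<in>M. c u = y} \<noteq> 0" by simp
    then have "{u\<in>M. c u = y} \<noteq> {}" by (metis card.empty)
    then show "y \<in> c ` M" by auto
  qed
qed (use assms in simp)

text \<open>The fibres over repeated values are disjoint subsets of \<open>M\<close> with at least
  two elements each.\<close>

lemma card_repeated_values:
  assumes "finite M"
  shows "2 * card {y. 2 \<le> card {u\<in>M. c u = y}} \<le> card M"
proof -
  let ?Y = "{y. 2 \<le> card {u\<in>M. c u = y}}"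
  have fin: "finite ?Y" using assms by (rule finite_repeated_values)
  have "2 * card ?Y = (\<Sum>y\<in>?Y. 2)" by simp
  also have "\<dots> \<le> (\<Sum>y\<in>?Y. card {u\<in>M. c u = y})" by (rule sum_mono) simp
  also have "\<dots> = card (\<Union>y\<in>?Y. {u\<in>M. c u = y})"
    using fin assms by (subst card_UN_disjoint) auto
  also have "\<dots> \<le> card M" by (rule card_mono[OF assms]) auto
  finally show ?thesis .
qed

section \<open>Extending a colouring to removed vertices\<close>

definition arborable_coloring :: "('a \<Rightarrow> 'a set) \<Rightarrow> ('a \<Rightarrow> 'c set) \<Rightarrow> nat \<Rightarrow> 'a set \<Rightarrow> ('a \<Rightarrow> 'c) \<Rightarrow> bool"
  where "arborable_coloring N L m W c \<longleftrightarrow> (\<forall>v\<in>W. c v \<in> L v) \<and>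
    (\<forall>y. degenerate_on N 1 {v\<in>W. c v = y} \<and> card {v\<in>W. c v = y} \<le> m)"

lemma arborable_coloring_extend:
  assumes W: "finite W" and vs: "distinct vs" "set vs \<subseteq> W" "length vs \<le> k"
    and irr: "\<And>v. v \<notin> N v"
    and L: "\<And>v. v \<in> W \<Longrightarrow> finite (L v) \<and> card (L v) = k"
    and deg: "\<And>j. j < length vs \<Longrightarrow> card (N (vs ! j) \<inter> (W - set vs)) \<le> 2 * j + 1"
    and c: "arborable_coloring N L m (W - set vs) c"
  obtains c' where "arborable_coloring N L (Suc m) W c'"
proof -
  define S where "S = set vs"
  \<comment> \<open>These are the colours of \<open>L v\<close> seen at most once among the already
    coloured neighbours of \<open>v\<close>, so that using one of them at \<open>v\<close> closes no
    cycle.\<close>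
  define A where "A v = L v - {y. 2 \<le> card {u \<in> N v \<inter> (W - S). c u = y}}" for v
  have "length vs - j \<le> card (A (vs ! j))" if j: "j < length vs" for j
  proof -
    let ?M = "N (vs ! j) \<inter> (W - S)" and ?Y = "{y. 2 \<le> card {u \<in> N (vs ! j) \<inter> (W - S). c u = y}}"
    have "2 * card ?Y \<le> card ?M" using W by (intro card_repeated_values) auto
    then have "card ?Y \<le> j" using deg[OF j] unfolding S_def by linarith
    moreover have "card (L (vs ! j)) = k" "finite (L (vs ! j))" using L vs(2) j nth_mem by blast+
    \<comment> \<open>Repeated colours may lie outside the list, so only their intersection with it
      is lost.\<close>
    moreover have "card (L (vs ! j)) - card ?Y \<le> card (L (vs ! j) - ?Y)"
    proof -
      have "card (L (vs ! j)) - card (L (vs ! j) \<inter> ?Y) = card (L (vs ! j) - ?Y)"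
        using \<open>finite (L (vs ! j))\<close> by (simp add: card_Diff_subset_Int)
      moreover have "card (L (vs ! j) \<inter> ?Y) \<le> card ?Y"
        using W by (intro card_mono finite_repeated_values) auto
      ultimately show ?thesis by linarith
    qed
    ultimately show ?thesis using vs(3) unfolding A_def by linarith
  qed
  from distinct_representatives_greedy[OF vs(1) this]
  obtain d where d: "inj_on d S" "\<And>v. v \<in> S \<Longrightarrow> d v \<in> A v" unfolding S_def by blast
  define c' where "c' v = (if v \<in> S then d v else c v)" for v
  have "degenerate_on N 1 {v\<in>W. c' v = y} \<and> card {v\<in>W. c' v = y} \<le> Suc m" for y
  proof -
    let ?C = "{v \<in> W - S. c v = y}"
    have C: "degenerate_on N 1 ?C" "card ?C \<le> m"
      using c unfolding arborable_coloring_def S_def by auto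
    show ?thesis
    proof (cases "y \<in> d ` S")
      case False
      then have "{v\<in>W. c' v = y} = ?C" unfolding c'_def by auto
      with C show ?thesis by simp
    next
      case True
      then obtain v where v: "v \<in> S" "d v = y" by blast
      \<comment> \<open>By injectivity of \<open>d\<close>, no other removed vertex receives the
        colour \<open>y\<close>.\<close>
      then have eq: "{v\<in>W. c' v = y} = insert v ?C"
        using d(1) vs(2) unfolding c'_def S_def by (auto simp: inj_on_def)
      have "{u \<in> N v \<inter> (W - S). c u = y} = N v \<inter> ?C" by auto
      then have "card (N v \<inter> ?C) \<le> 1" using d(2)[OF v(1)] v(2) unfolding A_def by auto
      then have "degenerate_on N 1 (insert v ?C)"
        using C(1) W irr by (intro degenerate_on_insert) auto
      moreover have "card (insert v ?C) \<le> Suc m" using C(2) W by (simp add: card_insert_if)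
      ultimately show ?thesis unfolding eq by simp
    qed
  qed
  moreover have "\<forall>v\<in>W. c' v \<in> L v"
    using c d(2) unfolding c'_def arborable_coloring_def A_def S_def by auto
  ultimately show thesis using that unfolding arborable_coloring_def by blast
qed

section \<open>Choosing the vertices to remove\<close>

text \<open>A vertex of degree at most \<open>d\<close> is removed \<open>n\<close> times; later
  removals only shrink the neighbourhoods of earlier choices.\<close>

lemma degenerate_on_successive_vertices:
  assumes "finite W" "degenerate_on N d W" "n \<le> card W"
  shows "\<exists>ws. distinct ws \<and> length ws = n \<and> set ws \<subseteq> W \<and>
    (\<forall>w\<in>set ws. card (N w \<inter> (W - set ws)) \<le> d)"
  using assms
proof (induction n arbitrary: W)
  case 0
  then show ?case by simp
next
  case (Suc n)
  have "W \<noteq> {}" using Suc.prems(3) by auto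
  with Suc.prems(2) obtain w where w: "w \<in> W" "card (N w \<inter> W) \<le> d"
    by (auto elim: degenerate_onD)
  have "n \<le> card (W - {w})" using Suc.prems w by simp
  with Suc.IH[of "W - {w}"] Suc.prems degenerate_on_subset[of N d W "W - {w}"]
  obtain ws where ws: "distinct ws" "length ws = n" "set ws \<subseteq> W - {w}"
    "\<forall>v\<in>set ws. card (N v \<inter> (W - {w} - set ws)) \<le> d" by auto
  have "card (N w \<inter> (W - set (w # ws))) \<le> card (N w \<inter> W)"
    using Suc.prems by (intro card_mono) auto
  moreover have "W - set (w # ws) = W - {w} - set ws" by auto
  ultimately show ?case using ws w by (intro exI[of _ "w # ws"]) auto
qed

text \<open>Supplies the first and the last two vertices of the list to be removed. The final
  alternative records why \<open>a\<close> has few neighbours outside the triple: directly, or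
  because two of its neighbours lie in the triple.\<close>

lemma exists_reducible_triple:
  assumes W: "finite W" "3 \<le> card W" and deg: "degenerate_on N 3 W"
    and irr: "\<And>v. v \<notin> N v" and sym: "\<And>u v. u \<in> N v \<Longrightarrow> v \<in> N u"
    and claw: "\<And>x a b c. a \<in> N x \<Longrightarrow> b \<in> N x \<Longrightarrow> c \<in> N x \<Longrightarrow> distinct [a, b, c] \<Longrightarrow>
      b \<in> N a \<or> c \<in> N a \<or> c \<in> N b"
  obtains x a b where "distinct [x, a, b]" "{x, a, b} \<subseteq> W" "card (N x \<inter> (W - {x, a, b})) \<le> 1"
    "card (N a \<inter> (W - {x, a, b})) \<le> 3 \<or> x \<in> N a \<and> b \<in> N a"
proof -
  have "W \<noteq> {}" using W by auto
  with deg obtain x where x: "x \<in> W" "card (N x \<inter> W) \<le> 3" by (auto elim: degenerate_onD)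
  show thesis
  proof (cases "card (N x \<inter> W) = 3")
    case True
    then obtain p q r where pqr: "N x \<inter> W = {p, q, r}" "distinct [p, q, r]"
      by (auto simp: card_3_iff)
    then have "q \<in> N p \<or> r \<in> N p \<or> r \<in> N q" using claw[of p x q r] by blast
    \<comment> \<open>The edge among the three neighbours is named \<open>a\<close>,
      \<open>b\<close>; then \<open>c\<close> is the only neighbour of \<open>x\<close> in
      \<open>W\<close> that stays outside the triple.\<close>
    then obtain a b c where abc: "N x \<inter> W = {a, b, c}" "distinct [a, b, c]" "b \<in> N a"
    proof (elim disjE)
      assume "q \<in> N p"
      with pqr that[of p q r] show thesis by auto
    next
      assume "r \<in> N p"
      with pqr that[of p r q] show thesis by auto
    next
      assume "r \<in> N q"
      with pqr that[of q r p] show thesis by auto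
    qed
    have ab: "a \<in> N x" "b \<in> N x" "a \<in> W" "b \<in> W" using abc(1) by auto
    have "N x \<inter> (W - {x, a, b}) \<subseteq> {c}" using abc(1) by auto
    then have "card (N x \<inter> (W - {x, a, b})) \<le> card {c}" by (intro card_mono) auto
    with ab abc x irr sym show thesis by (intro that[of x a b]) auto
  next
    case False
    then have le2: "card (N x \<inter> W) \<le> 2" using x by simp
    \<comment> \<open>If \<open>x\<close> has no neighbour in \<open>W\<close>, any other vertex
      serves as \<open>b\<close>.\<close>
    obtain b where b: "b \<in> W" "b \<noteq> x" "card (N x \<inter> W - {b}) \<le> 1"
    proof (cases "N x \<inter> W = {}")
      case True
      have "card (W - {x}) \<noteq> 0" using W x by simp
      then obtain b where "b \<in> W - {x}" by (metis card.empty ex_in_conv)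
      with True that[of b] show thesis by simp
    next
      case False
      then obtain b where "b \<in> N x" "b \<in> W" by auto
      moreover have "b \<noteq> x" using \<open>b \<in> N x\<close> irr by blast
      ultimately show thesis using le2 W that[of b] by simp
    qed
    have "card (W - {x, b}) \<noteq> 0" using W x b by (simp add: card_Diff_subset)
    then have "W - {x, b} \<noteq> {}" by (metis card.empty)
    with deg obtain a where a: "a \<in> W - {x, b}" "card (N a \<inter> (W - {x, b})) \<le> 3"
      by (auto elim: degenerate_onD[of N 3 W "W - {x, b}"])
    have "card (N a \<inter> (W - {x, a, b})) \<le> card (N a \<inter> (W - {x, b}))"
      "card (N x \<inter> (W - {x, a, b})) \<le> card (N x \<inter> W - {b})"
      using W by (auto intro!: card_mono)
    with a b x show thesis by (intro that[of x a b]) auto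
  qed
qed

text \<open>In the order \<open>x\<close>, \<open>ws\<close>, \<open>a\<close>, \<open>b\<close> the
  bounds are 1, then 3, then \<open>2 * k - 3\<close> and \<open>2 * k - 1\<close>. The last two are
  \<open>2 * j + 1\<close> at \<open>j = k - 2\<close> and \<open>j = k - 1\<close>, and 3 is enough
  from \<open>j = 1\<close> on.\<close>

lemma exists_reducible_list:
  assumes W: "finite W" "k \<le> card W" and k: "3 \<le> k" and deg: "degenerate_on N 3 W"
    and irr: "\<And>v. v \<notin> N v" and sym: "\<And>u v. u \<in> N v \<Longrightarrow> v \<in> N u"
    and claw: "\<And>x a b c. a \<in> N x \<Longrightarrow> b \<in> N x \<Longrightarrow> c \<in> N x \<Longrightarrow> distinct [a, b, c] \<Longrightarrow>
      b \<in> N a \<or> c \<in> N a \<or> c \<in> N b"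
    and max_deg: "\<And>v. v \<in> W \<Longrightarrow> card (N v \<inter> W) \<le> 2 * k - 1"
  obtains vs where "distinct vs" "set vs \<subseteq> W" "length vs = k"
    "\<forall>j<k. card (N (vs ! j) \<inter> (W - set vs)) \<le> 2 * j + 1"
proof -
  have card3: "3 \<le> card W" using W k by simp
  obtain x a b where xab: "distinct [x, a, b]" "{x, a, b} \<subseteq> W" "card (N x \<inter> (W - {x, a, b})) \<le> 1"
    "card (N a \<inter> (W - {x, a, b})) \<le> 3 \<or> x \<in> N a \<and> b \<in> N a"
    by (rule exists_reducible_triple[OF W(1) card3 deg irr sym claw])
  let ?R = "W - {x, a, b}"
  have "card ?R = card W - 3" using xab(1,2) W(1) by (simp add: card_Diff_subset)
  then have "k - 3 \<le> card ?R" using W by simp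
  from degenerate_on_successive_vertices[OF _ degenerate_on_subset[OF deg] this]
  obtain ws where ws: "distinct ws" "length ws = k - 3" "set ws \<subseteq> ?R"
    "\<And>w. w \<in> set ws \<Longrightarrow> card (N w \<inter> (?R - set ws)) \<le> 3"
    using W(1) by auto
  define vs where "vs = x # ws @ [a, b]"
  have len: "length vs = k" and dist: "distinct vs" and sub: "set vs \<subseteq> W"
    using ws xab k unfolding vs_def by auto
  have R: "W - set vs = ?R - set ws" unfolding vs_def by auto
  have mono: "card (N v \<inter> (W - set vs)) \<le> card (N v \<inter> ?R)" "card (N v \<inter> ?R) \<le> card (N v \<inter> W)" for v
    using W(1) unfolding R by (auto intro!: card_mono)
  have a: "card (N a \<inter> ?R) \<le> 2 * k - 3"
    using xab(4)
  proof
    \<comment> \<open>Two of the at most \<open>2 * k - 1\<close> neighbours of \<open>a\<close> are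
      \<open>x\<close> and \<open>b\<close>. The other alternative, closed at the end, needs only
      \<open>3 \<le> 2 * k - 3\<close>, which follows from \<open>3 \<le> k\<close>.\<close>
    assume "x \<in> N a \<and> b \<in> N a"
    then have xb: "{x, b} \<subseteq> N a \<inter> W" using xab(2) by auto
    have "N a \<inter> ?R = N a \<inter> W - {x, b}" using irr by auto
    also have "card \<dots> = card (N a \<inter> W) - 2"
      using xb xab(1) by (subst card_Diff_subset) auto
    also have "\<dots> \<le> 2 * k - 3" using max_deg[of a] xab(2) by simp
    finally show ?thesis .
  qed (use k in simp)
  have "card (N (vs ! j) \<inter> (W - set vs)) \<le> 2 * j + 1" if "j < k" for j
  proof -
    have "j = 0 \<or> 0 < j \<and> j < k - 2 \<or> j = k - 2 \<or> j = k - 1" using that by linarith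
    then consider "j = 0" | "0 < j" "j < k - 2" | "j = k - 2" | "j = k - 1" by blast
    then show ?thesis
    proof cases
      case 1
      then show ?thesis using mono(1)[of x] xab(3) unfolding vs_def by simp
    next
      case 2
      then have "vs ! j = ws ! (j - 1)" "j - 1 < length ws"
        using ws(2) unfolding vs_def by (auto simp: nth_append nth_Cons')
      then have "card (N (vs ! j) \<inter> (W - set vs)) \<le> 3" unfolding R using ws(4) nth_mem by metis
      then show ?thesis using 2 by linarith
    next
      case 3
      then have "vs ! j = a" using ws(2) k unfolding vs_def by (auto simp: nth_append nth_Cons')
      then show ?thesis using mono(1)[of a] a 3 k by simp
    next
      case 4
      then have "vs ! j = b" using ws(2) k unfolding vs_def by (auto simp: nth_append nth_Cons')
      then show ?thesis using mono[of b] max_deg[of b] xab(2) 4 k by simp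
    qed
  qed
  with dist sub len that show thesis by blast
qed

section \<open>Induction on the size bound of the colour classes\<close>

text \<open>Each unit of \<open>m\<close> pays for one round of removing \<open>k\<close> vertices.
  All hypotheses on \<open>W\<close> pass to subsets, with \<open>k\<close> kept fixed.\<close>

lemma exists_arborable_coloring:
  assumes W: "finite W" "card W \<le> k * m" and k: "3 \<le> k" and deg: "degenerate_on N 3 W"
    and irr: "\<And>v. v \<notin> N v" and sym: "\<And>u v. u \<in> N v \<Longrightarrow> v \<in> N u"
    and claw: "\<And>x a b c. a \<in> N x \<Longrightarrow> b \<in> N x \<Longrightarrow> c \<in> N x \<Longrightarrow> distinct [a, b, c] \<Longrightarrow>
      b \<in> N a \<or> c \<in> N a \<or> c \<in> N b"
    and max_deg: "\<And>v. v \<in> W \<Longrightarrow> card (N v \<inter> W) \<le> 2 * k - 1"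
    and L: "\<And>v. v \<in> W \<Longrightarrow> finite (L v) \<and> card (L v) = k"
  shows "\<exists>c. arborable_coloring N L m W c"
  using W deg max_deg L
proof (induction m arbitrary: W)
  case 0
  then show ?case by (auto simp: arborable_coloring_def degenerate_on_def)
next
  case (Suc m)
  obtain vs where vs: "distinct vs" "set vs \<subseteq> W" "length vs \<le> k" "card (W - set vs) \<le> k * m"
    "\<And>j. j < length vs \<Longrightarrow> card (N (vs ! j) \<inter> (W - set vs)) \<le> 2 * j + 1"
  proof (cases "k \<le> card W")
    case True
    obtain vs where vs: "distinct vs" "set vs \<subseteq> W" "length vs = k"
      "\<forall>j<k. card (N (vs ! j) \<inter> (W - set vs)) \<le> 2 * j + 1"
      by (rule exists_reducible_list[OF Suc.prems(1) True k Suc.prems(3) irr sym claw Suc.prems(4)])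
    then have "card (W - set vs) = card W - k"
      using Suc.prems(1) by (simp add: card_Diff_subset distinct_card)
    with vs Suc.prems(2) that[of vs] show thesis by simp
  next
    \<comment> \<open>Fewer than \<open>k\<close> vertices are all removed at once; nothing remains,
      so the degree bounds are trivial.\<close>
    case False
    from finite_distinct_list[OF Suc.prems(1)] obtain vs where "set vs = W" "distinct vs" by blast
    with False that[of vs] distinct_card[of vs] show thesis by simp
  qed
  have "card (N v \<inter> (W - set vs)) \<le> 2 * k - 1" if "v \<in> W" for v
  proof -
    have "card (N v \<inter> (W - set vs)) \<le> card (N v \<inter> W)" using Suc.prems(1) by (intro card_mono) auto
    with Suc.prems(4)[OF that] show ?thesis by simp
  qed
  with Suc.IH[of "W - set vs"] vs(4) Suc.prems degenerate_on_subset[of N 3 W "W - set vs"]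
  obtain c where "arborable_coloring N L m (W - set vs) c" by auto
  from arborable_coloring_extend[OF Suc.prems(1) vs(1-3) irr Suc.prems(5) vs(5) this]
  show ?case by blast
qed

section \<open>Translation from digraphs to neighbourhoods\<close>

abbreviation neighbors :: "('a, 'b) pre_digraph \<Rightarrow> 'a \<Rightarrow> 'a set" where
  "neighbors G v \<equiv> {u. v \<rightarrow>\<^bsub>G\<^esub> u}"

lemma (in graph) graph_induce_subgraph:
  assumes "W \<subseteq> verts G"
  shows "graph (G \<restriction> W)"
proof -
  have ind: "induced_subgraph (G \<restriction> W) G" using assms by (rule induced_induce)
  interpret H: digraph "G \<restriction> W" using ind by (rule digraphI_induced)
  interpret H: sym_digraph "G \<restriction> W" using ind by (rule induced_graph_imp_graph)
  show ?thesis by unfold_locales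
qed

text \<open>Without parallel arcs, an arc leaving \<open>v\<close> is determined by its
  head.\<close>

lemma (in graph) out_degree_induce_subgraph:
  assumes "v \<in> W"
  shows "out_degree (G \<restriction> W) v = card (neighbors G v \<inter> W)"
proof -
  have "head G ` out_arcs (G \<restriction> W) v = neighbors G v \<inter> W"
    using assms by (auto simp: out_arcs_def arcs_ends_conv)
  moreover have "inj_on (head G) (out_arcs (G \<restriction> W) v)"
    by (auto simp: inj_on_def out_arcs_def arc_to_ends_def intro: no_multi_arcs)
  ultimately show ?thesis unfolding out_degree_def by (metis card_image)
qed

lemma (in graph) degenerate_imp_degenerate_on:
  assumes "degenerate d G"
  shows "degenerate_on (neighbors G) d (verts G)"
  unfolding degenerate_on_def
proof (intro allI impI)
  fix B assume B: "B \<subseteq> verts G" "B \<noteq> {}"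
  then have "subgraph (G \<restriction> B) G" "graph (G \<restriction> B)"
    by (auto intro: graph_induce_subgraph induced_imp_subgraph)
  with assms B obtain v where "v \<in> B" "out_degree (G \<restriction> B) v \<le> d"
    unfolding degenerate_def by (metis induce_subgraph_verts)
  then show "\<exists>v\<in>B. card (neighbors G v \<inter> B) \<le> d" using out_degree_induce_subgraph by metis
qed

text \<open>Otherwise \<open>x\<close> and its three pairwise non-adjacent neighbours induce a claw
  with centre \<open>x\<close>.\<close>

lemma (in graph) claw_free_neighbors:
  assumes "claw_free G" "a \<in> neighbors G x" "b \<in> neighbors G x" "c \<in> neighbors G x" "distinct [a, b, c]"
  shows "b \<in> neighbors G a \<or> c \<in> neighbors G a \<or> c \<in> neighbors G b"
proof (rule ccontr)
  assume neg: "\<not> ?thesis"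
  let ?W = "{x, a, b, c}"
  have sym: "u \<rightarrow>\<^bsub>G\<^esub> v \<longleftrightarrow> v \<rightarrow>\<^bsub>G\<^esub> u" for u v using sym_arcs arcs_ends_symmetric by metis
  have irr: "\<not> u \<rightarrow>\<^bsub>G\<^esub> u" for u using adj_not_same by blast
  have W: "?W \<subseteq> verts G" using assms adj_in_verts by auto
  have ends: "arcs_ends (G \<restriction> ?W) = arcs_ends G \<inter> ?W \<times> ?W" by (auto simp: arcs_ends_conv)
  have "arcs_ends (G \<restriction> ?W) = {x} \<times> {a, b, c} \<union> {a, b, c} \<times> {x}"
    unfolding ends using assms(2-4) neg irr sym by auto
  moreover have "{x} \<inter> {a, b, c} = {}" using assms(2-4) irr by auto
  moreover have "card {a, b, c} = 3" using assms(5) by simp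
  moreover have "verts (G \<restriction> ?W) = {x} \<union> {a, b, c}" by auto
  ultimately have "complete_bipartite_digraph 1 3 (G \<restriction> ?W)"
    unfolding complete_bipartite_digraph_def using graph_induce_subgraph[OF W]
    by (intro conjI exI[of _ "{x}"] exI[of _ "{a, b, c}"]) simp_all
  with assms(1) W show False unfolding claw_free_def by (meson induced_induce)
qed

text \<open>An indexed form of the recursive \<open>cas\<close>, for addressing the vertices of a
  cycle by position.\<close>

lemma (in pre_digraph) cas_nth:
  assumes "cas u p v" "i < length p"
  shows "tail G (p ! i) = (if i = 0 then u else head G (p ! (i - 1)))"
  using assms by (induction p arbitrary: u i) (auto simp: nth_Cons split: nat.splits)

lemma (in pre_digraph) cas_last: "cas u p v \<Longrightarrow> p \<noteq> [] \<Longrightarrow> head G (p ! (length p - 1)) = v"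
  by (induction p arbitrary: u) (auto simp: nth_Cons' neq_Nil_conv)

text \<open>Every vertex of a cycle has two neighbours on it, so the vertices of a cycle are not
  1-degenerate.\<close>

lemma (in graph) degenerate_on_imp_acyclic_graph:
  assumes "W \<subseteq> verts G" "degenerate_on (neighbors G) 1 W"
  shows "acyclic_graph (G \<restriction> W)"
  unfolding acyclic_graph_def
proof
  assume "\<exists>p. pre_digraph.cycle (G \<restriction> W) p \<and> 3 \<le> length p"
  then obtain p where p: "pre_digraph.cycle (G \<restriction> W) p" and len: "3 \<le> length p" by blast
  interpret H: graph "G \<restriction> W" using assms(1) by (rule graph_induce_subgraph)
  from p obtain u where u: "H.awalk u p u" "distinct (tl (H.awalk_verts u p))" "p \<noteq> []"
    unfolding H.cycle_def by blast
  have cas: "H.cas u p u" and arcs: "set p \<subseteq> arcs (G \<restriction> W)"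
    using u(1) unfolding H.awalk_def by auto
  define n where "n = length p"
  \<comment> \<open>The vertices of the cycle are listed as heads of its arcs, so the common start
    and end \<open>u\<close> occurs only once, as the last head.\<close>
  define h where "h i = head G (p ! i)" for i
  have dist: "distinct (map (head G) p)"
    using u(2,3) H.awalk_verts_conv'[OF cas] by simp
  have h_inj: "i = j" if "h i = h j" "i < n" "j < n" for i j
    using nth_eq_iff_index_eq[OF dist, of i j] that unfolding h_def n_def by simp
  have arc: "p ! i \<in> arcs G" "h i \<in> W" if "i < n" for i
    using subsetD[OF arcs nth_mem[of i p]] that unfolding n_def h_def by auto
  \<comment> \<open>Index 0 wraps around to \<open>n - 1\<close>, since the walk ends where it
    starts.\<close>
  have adj: "h (if i = 0 then n - 1 else i - 1) \<rightarrow>\<^bsub>G\<^esub> h i" if "i < n" for i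
  proof -
    have "tail G (p ! i) = h (if i = 0 then n - 1 else i - 1)"
      using H.cas_nth[OF cas, of i] H.cas_last[OF cas u(3)] that unfolding h_def n_def by auto
    then show ?thesis using in_arcs_imp_in_arcs_ends[OF arc(1)[OF that]] unfolding h_def by simp
  qed
  let ?B = "h ` {..<n}"
  have "?B \<subseteq> W" "?B \<noteq> {}" using arc len unfolding n_def by (auto simp: lessThan_empty_iff)
  with assms(2) obtain v where v: "v \<in> ?B" "card (neighbors G v \<inter> ?B) \<le> 1"
    by (rule degenerate_onD)
  then obtain i where i: "i < n" "v = h i" by auto
  define prev nxt where "prev = (if i = 0 then n - 1 else i - 1)" and "nxt = (if i = n - 1 then 0 else i + 1)"
  have n: "3 \<le> n" using len unfolding n_def .
  \<comment> \<open>For \<open>n = 2\<close> both positions would coincide; a length of at least 3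
    separates them.\<close>
  have lt: "prev < n" "nxt < n" "prev \<noteq> nxt" using i n unfolding prev_def nxt_def by auto
  have "h prev \<rightarrow>\<^bsub>G\<^esub> v" using adj[OF i(1)] i(2) unfolding prev_def by simp
  then have "h prev \<in> neighbors G v" using arcs_ends_symmetric[OF sym_arcs] by blast
  moreover have "h nxt \<in> neighbors G v"
    using adj[OF lt(2)] i n unfolding nxt_def by (auto split: if_splits)
  ultimately have "{h prev, h nxt} \<subseteq> neighbors G v \<inter> ?B" using lt by auto
  then have "card {h prev, h nxt} \<le> card (neighbors G v \<inter> ?B)" by (intro card_mono) auto
  moreover have "h prev \<noteq> h nxt" using lt h_inj by blast
  ultimately show False using v(2) by simp
qed

theorem theorem3:
  fixes G :: "('a, 'b) pre_digraph" and k :: nat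
  assumes "graph G"
    and "degenerate 3 G"
    and "claw_free G"
    and "int k \<ge> max \<lceil>(real (max_degree G) + 1) / 2\<rceil> 3"
  shows "equitable_list_point_arborable TYPE('c) k G"
  unfolding equitable_list_point_arborable_def
proof (intro allI impI)
  fix L :: "'a \<Rightarrow> 'c set" assume L: "list_assignment k G L"
  interpret graph G by fact
  have k: "3 \<le> k" using assms(4) by simp
  have "\<lceil>(real (max_degree G) + 1) / 2\<rceil> \<le> int k" using assms(4) by simp
  \<comment> \<open>The ceiling bound amounts to
    \<open>max_degree G + 1 \<le> 2 * k\<close>.\<close>
  then have \<Delta>: "max_degree G \<le> 2 * k - 1" by (simp add: ceiling_le_iff)
  have max_deg: "card (neighbors G v \<inter> verts G) \<le> 2 * k - 1" if "v \<in> verts G" for v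
  proof -
    have "card (neighbors G v \<inter> verts G) = out_degree (G \<restriction> verts G) v"
      using that by (simp add: out_degree_induce_subgraph)
    also have "out_arcs (G \<restriction> verts G) v = out_arcs G v" by (auto simp: out_arcs_def)
    then have "out_degree (G \<restriction> verts G) v = out_degree G v" by (simp add: out_degree_def)
    also have "\<dots> \<le> max_degree G" unfolding max_degree_def using that by (intro Max_ge) auto
    finally show ?thesis using \<Delta> by simp
  qed
  define m where "m = nat \<lceil>real (card (verts G)) / real k\<rceil>"
  have "real (card (verts G)) / real k \<le> real m" unfolding m_def by linarith
  then have "real (card (verts G)) \<le> real (k * m)" using k by (simp add: field_simps)
  then have card: "card (verts G) \<le> k * m" by linarith
  have irr: "v \<notin> neighbors G v" for v using adj_not_same by auto
  have sym: "v \<in> neighbors G u" if "u \<in> neighbors G v" for u v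
    using that arcs_ends_symmetric[OF sym_arcs] by blast
  have lists: "finite (L v) \<and> card (L v) = k" if "v \<in> verts G" for v
    using L that unfolding list_assignment_def by blast
  have "\<exists>c. arborable_coloring (neighbors G) L m (verts G) c"
    by (rule exists_arborable_coloring[OF finite_verts card k degenerate_imp_degenerate_on[OF assms(2)]
      irr sym claw_free_neighbors[OF assms(3)] max_deg lists])
  then obtain c where c: "arborable_coloring (neighbors G) L m (verts G) c" ..
  \<comment> \<open>Nonnegativity makes \<open>nat\<close> in the definition of \<open>m\<close>
    lossless.\<close>
  have "0 \<le> real (card (verts G)) / real k" by simp
  then have m: "int m = \<lceil>real (card (verts G)) / real k\<rceil>" unfolding m_def by linarith
  show "\<exists>c. (\<forall>v\<in>verts G. c v \<in> L v) \<and>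
      (\<forall>x. acyclic_graph (G \<restriction> color_class G c x)) \<and>
      (\<forall>x. int (card (color_class G c x)) \<le> \<lceil>real (card (verts G)) / real k\<rceil>)"
  proof (intro exI[of _ c] conjI allI)
    show "\<forall>v\<in>verts G. c v \<in> L v" using c unfolding arborable_coloring_def by blast
    fix x
    have "degenerate_on (neighbors G) 1 (color_class G c x)" "card (color_class G c x) \<le> m"
      using c unfolding arborable_coloring_def color_class_def by auto
    moreover have "color_class G c x \<subseteq> verts G" unfolding color_class_def by blast
    ultimately show "acyclic_graph (G \<restriction> color_class G c x)"
      "int (card (color_class G c x)) \<le> \<lceil>real (card (verts G)) / real k\<rceil>"
      unfolding m[symmetric] by (simp_all add: degenerate_on_imp_acyclic_graph)
  qed
qed

end
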